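(* Let $K$ be a field, let $r\ge 1$, $s\ge 1$ be integers, $k=r+s$, and let $a_0,\dots,a_k\in K$ with $a_s\neq 0$ and $a_{s+r}\neq 0$. Let $T_n$ be the $n\times n$ Toeplitz band matrix and $C$ the $k\times k$ companion matrix determined by $r,s,a_0,\dots,a_k$ as defined in the context. For every integer $n\ge k$, if $M$ denotes the upper left $s\times s$ submatrix of $C^{n}$, then $$\det(T_n)=(-1)^{ns}\,a_s^{n}\cdot\det(M).$$
   Context: $T_n$ is the $n\times n$ matrix over $K$ with entries $(T_n)_{i,j}=a_{j-i}$ if $0\le j-i\le s$, $(T_n)_{i,j}=a_{s+(i-j)}$ if $1\le i-j\le r$, and $(T_n)_{i,j}=0$ otherwise. (So $a_0$ is on the diagonal, $a_1,\dots,a_s$ are on the superdiagonals, and $a_{s+1},\dots,a_{s+r}$ are on the subdiagonals.) $C$ is the $k\times k$ matrix over $K$ whose first column is $\left[-\frac{a_{s-1}}{a_s},\dots,-\frac{a_1}{a_s},-\frac{a_0}{a_s},-\frac{a_{s+1}}{a_s},\dots,-\frac{a_{s+r}}{a_s}\right]^t$, i.e. $C_{j,1}=-a_{s-j}/a_s$ for $1\le j\le s$ and $C_{j,1}=-a_j/a_s$ for $s<j\le k$, with $C_{j,j+1}=1$ for $1\le j\le k-1$, and all other entries $0$. *)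

theory Defs
  imports "Jordan_Normal_Form.Determinant" "Jordan_Normal_Form.DL_Submatrix"
begin

text \<open>Matrices are indexed from 0, so the entry at (i,j) below is the entry in row i + 1 and
  column j + 1 of the usual numbering.  The coefficients form a sequence of which only
  a 0, ..., a (r + s) are used.\<close>

definition toeplitz_band :: "nat \<Rightarrow> nat \<Rightarrow> (nat \<Rightarrow> 'a :: zero) \<Rightarrow> nat \<Rightarrow> 'a mat" where
  "toeplitz_band r s a n = mat n n (\<lambda>(i, j).
     if i \<le> j \<and> j - i \<le> s then a (j - i)
     else if j < i \<and> i - j \<le> r then a (s + (i - j))
     else 0)"

text \<open>The first column is, from top to bottom, the negative quotient by a s of
  a (s - 1), ..., a 0, a (s + 1), ..., a (s + r).\<close>

definition toeplitz_companion :: "nat \<Rightarrow> nat \<Rightarrow> (nat \<Rightarrow> 'a :: field) \<Rightarrow> 'a mat" where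
  "toeplitz_companion r s a = mat (r + s) (r + s) (\<lambda>(i, j).
     if j = 0 then (if i < s then - (a (s - (i + 1)) / a s) else - (a (i + 1) / a s))
     else if j = i + 1 then 1
     else 0)"

end

theory Submission
  imports Defs
begin

text \<open>
  Border \<open>T\<^sub>n\<close> by \<open>s\<close> further rows on top to get an \<open>(s + n) \<times> n\<close> band matrix whose
  column \<open>i\<close> holds \<open>a\<^sub>s, \<dots>, a\<^sub>0, a\<^sub>s\<^sub>+\<^sub>1, \<dots>, a\<^sub>s\<^sub>+\<^sub>r\<close> from row \<open>i\<close> downwards.  Appending
  the last \<open>s\<close> unit vectors as columns makes it a lower triangular matrix \<open>L\<close> with
  determinant \<open>a\<^sub>s\<^sup>n\<close>.  Row \<open>p\<close> of the powers of \<open>C\<close> runs through windows of a solution of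
  the linear recurrence given by the band; written out in decreasing order, these solutions
  form an \<open>s \<times> (s + n)\<close> matrix \<open>[M | W]\<close> that annihilates every column of the band and ends
  in the identity.  Hence
  \<open>[[M, W], [0, 1]] L = [[0, 1], [T\<^sub>n, F]]\<close>, and the claim follows by taking determinants.
\<close>

section \<open>Submatrices and block matrices\<close>

lemma pick_lessThan:
  assumes "i < m"
  shows "pick {..<m} i = i"
proof -
  have "{a \<in> {..<m}. a < i} = {..<i}" using assms by auto
  then show ?thesis using pick_card_in_set[of i "{..<m}"] assms by simp
qed

lemma submatrix_lessThan:
  assumes "m \<le> dim_row A" "m' \<le> dim_col A"
  shows "submatrix A {..<m} {..<m'} = mat m m' (\<lambda>(i, j). A $$ (i, j))"
proof -
  have "{i. i < dim_row A \<and> i \<in> {..<m}} = {..<m}" "{j. j < dim_col A \<and> j \<in> {..<m'}} = {..<m'}"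
    using assms by auto
  then show ?thesis
    unfolding submatrix_def by (intro eq_matI) (auto simp: pick_lessThan)
qed

text \<open>Rejoins the two halves of a block product into one sum over all \<open>s + n\<close>
  indices, the form in which the recurrence is applied.\<close>

lemma block_row_mult:
  fixes X Y :: "nat \<Rightarrow> nat \<Rightarrow> 'a :: semiring_0"
  shows "mat l s (\<lambda>(p, c). X p c) * mat s m (\<lambda>(c, j). Y c j)
      + mat l n (\<lambda>(p, c). X p (c + s)) * mat n m (\<lambda>(c, j). Y (c + s) j)
    = mat l m (\<lambda>(p, j). \<Sum>c<s + n. X p c * Y c j)"
proof (rule eq_matI)
  fix p j
  assume "p < dim_row (mat l m (\<lambda>(p, j). \<Sum>c<s + n. X p c * Y c j))"
    "j < dim_col (mat l m (\<lambda>(p, j). \<Sum>c<s + n. X p c * Y c j))"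
  then have pj: "p < l" "j < m" by auto
  have "(\<Sum>c<s + n. X p c * Y c j)
      = (\<Sum>c = 0..<s. X p c * Y c j) + (\<Sum>c = s..<s + n. X p c * Y c j)"
    by (simp add: sum.atLeastLessThan_concat lessThan_atLeast0)
  also have "(\<Sum>c = s..<s + n. X p c * Y c j) = (\<Sum>c = 0..<n. X p (c + s) * Y (c + s) j)"
    using sum.shift_bounds_nat_ivl[of "\<lambda>c. X p c * Y c j" 0 s n] by (simp add: add.commute)
  finally show "(mat l s (\<lambda>(p, c). X p c) * mat s m (\<lambda>(c, j). Y c j)
      + mat l n (\<lambda>(p, c). X p (c + s)) * mat n m (\<lambda>(c, j). Y (c + s) j)) $$ (p, j)
    = mat l m (\<lambda>(p, j). \<Sum>c<s + n. X p c * Y c j) $$ (p, j)"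
    using pj by (simp add: scalar_prod_def)
qed auto

text \<open>Moving the top \<open>s\<close> rows below the other \<open>n\<close> takes
  \<open>n * s\<close> adjacent swaps and leaves a block upper triangular matrix with an identity
  corner.\<close>

lemma det_four_block_mat_zero_one:
  fixes T :: "'a :: idom mat"
  assumes "T \<in> carrier_mat n n" "F \<in> carrier_mat n s"
  shows "det (four_block_mat (0\<^sub>m s n) (1\<^sub>m s) T F) = (- 1) ^ (n * s) * det T"
proof -
  let ?A = "four_block_mat (0\<^sub>m s n) (1\<^sub>m s) T F"
  have A: "?A \<in> carrier_mat (n + s) (n + s)"
    using assms by (intro carrier_matI) (simp_all only: index_mat_four_block carrier_matD
        index_zero_mat index_one_mat add.commute)
  have "mat (n + s) (n + s) (\<lambda>(i, j). ?A $$ (if i < n then i + s else i - n, j))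
      = four_block_mat T F (0\<^sub>m s n) (1\<^sub>m s)"
    using assms by (intro eq_matI) auto
  then show ?thesis
    using det_swap_rows[OF A] assms
    by (simp add: det_four_block_mat_lower_left_zero[OF assms refl one_carrier_mat])
qed

section \<open>The bordered band matrix\<close>

definition band_coeff :: "nat \<Rightarrow> (nat \<Rightarrow> 'a) \<Rightarrow> nat \<Rightarrow> 'a" where
  "band_coeff s a d = (if d \<le> s then a (s - d) else a d)"

text \<open>Row \<open>i + s\<close> is row \<open>i\<close> of the Toeplitz matrix and the rows
  \<open>c < s\<close> are the border; \<open>c - i\<close> is the depth below the top of the band
  in column \<open>i\<close>.\<close>

definition band_entry :: "nat \<Rightarrow> nat \<Rightarrow> (nat \<Rightarrow> 'a :: zero) \<Rightarrow> nat \<Rightarrow> nat \<Rightarrow> 'a" where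
  "band_entry r s a c i = (if i \<le> c \<and> c \<le> i + (r + s) then band_coeff s a (c - i) else 0)"

lemma toeplitz_band_eq:
  "toeplitz_band r s a n = mat n n (\<lambda>(i, j). band_entry r s a (i + s) j)"
proof (rule eq_matI)
  fix i j
  assume "i < dim_row (mat n n (\<lambda>(i, j). band_entry r s a (i + s) j))"
    "j < dim_col (mat n n (\<lambda>(i, j). band_entry r s a (i + s) j))"
  moreover have "s + (i - j) = i + s - j" if "j < i" using that by simp
  ultimately show "toeplitz_band r s a n $$ (i, j)
      = mat n n (\<lambda>(i, j). band_entry r s a (i + s) j) $$ (i, j)"
    by (auto simp: toeplitz_band_def band_entry_def band_coeff_def)
qed (auto simp: toeplitz_band_def)

section \<open>Powers of the companion matrix and the linear recurrence\<close>

context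
  fixes a :: "nat \<Rightarrow> 'a :: field" and r s :: nat
  assumes s: "s \<ge> 1" and as: "a s \<noteq> 0"
begin

abbreviation (input) "C \<equiv> toeplitz_companion r s a"

lemma companion_carrier: "C \<in> carrier_mat (r + s) (r + s)"
  by (simp add: toeplitz_companion_def)

lemma companion_pow_carrier: "C ^\<^sub>m t \<in> carrier_mat (r + s) (r + s)"
  using companion_carrier by simp

lemma companion_first_col:
  "l < r + s \<Longrightarrow> C $$ (l, 0) = - band_coeff s a (Suc l) / a s"
  by (auto simp: toeplitz_companion_def band_coeff_def)

lemma companion_pow_Suc:
  assumes "p < r + s" "j < r + s"
  shows "(C ^\<^sub>m Suc t) $$ (p, j) = (\<Sum>l<r + s. (C ^\<^sub>m t) $$ (p, l) * C $$ (l, j))"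
  using assms companion_carrier companion_pow_carrier[of t]
  by (simp add: scalar_prod_def lessThan_atLeast0)

lemma companion_pow_first_col:
  assumes "p < r + s"
  shows "(C ^\<^sub>m Suc t) $$ (p, 0) * a s
    = - (\<Sum>l<r + s. (C ^\<^sub>m t) $$ (p, l) * band_coeff s a (Suc l))"
proof -
  have "(C ^\<^sub>m Suc t) $$ (p, 0) * a s = (\<Sum>l<r + s. (C ^\<^sub>m t) $$ (p, l) * C $$ (l, 0) * a s)"
    using assms s by (simp add: companion_pow_Suc sum_distrib_right del: pow_mat.simps)
  also have "\<dots> = (\<Sum>l<r + s. - ((C ^\<^sub>m t) $$ (p, l) * band_coeff s a (Suc l)))"
    using as by (intro sum.cong) (auto simp: companion_first_col)
  finally show ?thesis by (simp add: sum_negf)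
qed

text \<open>Every column of \<open>C\<close> but the first is a unit vector, so right multiplication
  by \<open>C\<close> moves each column but the last one place to the right.\<close>

lemma companion_pow_shift:
  assumes "p < r + s" "j + d < r + s"
  shows "(C ^\<^sub>m (t + d)) $$ (p, j + d) = (C ^\<^sub>m t) $$ (p, j)"
  using assms(2)
proof (induction d)
  case (Suc d)
  have "(C ^\<^sub>m Suc (t + d)) $$ (p, Suc (j + d))
      = (\<Sum>l<r + s. (C ^\<^sub>m (t + d)) $$ (p, l) * C $$ (l, Suc (j + d)))"
    using assms(1) Suc.prems by (intro companion_pow_Suc) auto
  also have "\<dots> = (\<Sum>l<r + s. if l = j + d then (C ^\<^sub>m (t + d)) $$ (p, l) else 0)"
    using Suc.prems by (intro sum.cong) (auto simp: toeplitz_companion_def)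
  also have "\<dots> = (C ^\<^sub>m (t + d)) $$ (p, j + d)"
    using Suc.prems by simp
  finally show ?case using Suc by simp
qed simp

text \<open>By \<open>companion_pow_shift\<close> an entry of row \<open>p\<close> depends only on
  exponent minus column, here \<open>n - c\<close>. Column \<open>s - 1\<close> keeps the exponent
  nonnegative for all \<open>c < n + s\<close>.\<close>

definition recurrence_solution :: "nat \<Rightarrow> nat \<Rightarrow> nat \<Rightarrow> 'a" where
  "recurrence_solution n p c = (C ^\<^sub>m (n + s - 1 - c)) $$ (p, s - 1)"

lemma recurrence_solution_eq:
  assumes "p < r + s" "j < r + s" "c < n + s" "t + c = n + j"
  shows "recurrence_solution n p c = (C ^\<^sub>m t) $$ (p, j)"
proof (cases "j < s")
  case True
  define d where "d = s - 1 - j"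
  have "n + s - 1 - c = t + d" "s - 1 = j + d"
    using True assms by (auto simp: d_def)
  then show ?thesis
    using companion_pow_shift[of p j d t] assms(1) True
    by (simp add: recurrence_solution_def)
next
  case False
  define d where "d = j - (s - 1)"
  have "t = (n + s - 1 - c) + d" "j = (s - 1) + d"
    using False assms s unfolding d_def by linarith+
  then show ?thesis
    using companion_pow_shift[of p "s - 1" d "n + s - 1 - c"] assms(1,2)
    by (simp only: recurrence_solution_def)
qed

text \<open>Shifting back by \<open>t\<close> columns leads to the identity \<open>C^0\<close> in
  column \<open>l - t\<close>, which is at least \<open>s > p\<close> and so off the
  diagonal.\<close>

lemma companion_pow_eq_0:
  assumes "p < s" "s + t \<le> l" "l < r + s"
  shows "(C ^\<^sub>m t) $$ (p, l) = 0"
  using companion_pow_shift[of p "l - t" t 0] assms companion_carrier by auto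

lemma recurrence_solution_band:
  assumes p: "p < s" and i: "i < n"
  shows "(\<Sum>c<s + n. recurrence_solution n p c * band_entry r s a c i) = 0"
proof -
  \<comment> \<open>With this \<open>t\<close>, row \<open>c = i\<close> matches column 0 of
    \<open>C^(t + 1)\<close> and row \<open>c = l + 1 + i\<close> matches column \<open>l\<close> of
    \<open>C^t\<close>, so the sum is one step of the recurrence.\<close>
  define t where "t = n - 1 - i"
  have n: "n = Suc (t + i)" using i by (simp add: t_def)
  let ?x = "recurrence_solution n p"
  have "(\<Sum>c<s + n. ?x c * band_entry r s a c i)
      = (\<Sum>c = i..<s + n. ?x c * band_entry r s a c i)"
    by (rule sum.mono_neutral_right) (auto simp: band_entry_def)
  also have "\<dots> = (\<Sum>l = 0..<Suc (s + t). ?x (l + i) * band_entry r s a (l + i) i)"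
    using sum.shift_bounds_nat_ivl[of "\<lambda>c. ?x c * band_entry r s a c i" 0 i "Suc (s + t)"]
    by (simp add: n add.assoc)
  also have "\<dots> = ?x i * a s
      + (\<Sum>l<s + t. ?x (Suc l + i) * band_entry r s a (Suc l + i) i)"
    unfolding sum.atLeast0_lessThan_Suc_shift lessThan_atLeast0 o_def
    by (simp add: band_entry_def band_coeff_def)
  also have "?x i = (C ^\<^sub>m Suc t) $$ (p, 0)"
    using p i by (intro recurrence_solution_eq) (auto simp: n)
  also have "(\<Sum>l<s + t. ?x (Suc l + i) * band_entry r s a (Suc l + i) i)
      = (\<Sum>l<s + t. if l < r + s then (C ^\<^sub>m t) $$ (p, l) * band_coeff s a (Suc l) else 0)"
  proof (rule sum.cong[OF refl])
    fix l assume "l \<in> {..<s + t}"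
    then have "l < r + s \<Longrightarrow> ?x (Suc l + i) = (C ^\<^sub>m t) $$ (p, l)"
      using p by (intro recurrence_solution_eq) (auto simp: n)
    then show "?x (Suc l + i) * band_entry r s a (Suc l + i) i
        = (if l < r + s then (C ^\<^sub>m t) $$ (p, l) * band_coeff s a (Suc l) else 0)"
      by (auto simp: band_entry_def)
  qed
  also have "\<dots> = (\<Sum>l \<in> {..<s + t} \<inter> {..<r + s}. (C ^\<^sub>m t) $$ (p, l) * band_coeff s a (Suc l))"
    by (simp add: sum.inter_restrict)
  \<comment> \<open>For \<open>t < r\<close> the bottom edge cuts off the band column; the missing
    terms vanish by \<open>companion_pow_eq_0\<close>.\<close>
  also have "\<dots> = (\<Sum>l<r + s. (C ^\<^sub>m t) $$ (p, l) * band_coeff s a (Suc l))"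
  proof (rule sum.mono_neutral_left, goal_cases)
    case 3
    have "(C ^\<^sub>m t) $$ (p, l) = 0" if "l \<in> {..<r + s} - {..<s + t} \<inter> {..<r + s}" for l
      using that by (intro companion_pow_eq_0[OF p]) auto
    then show ?case by (intro ballI) (simp only: mult_zero_left)
  qed auto
  finally show ?thesis
    using p by (simp add: companion_pow_first_col del: pow_mat.simps)
qed

text \<open>The last \<open>s\<close> entries of a solution come from row \<open>p\<close> of the
  identity \<open>C^0\<close>, and the appended unit vectors pick them out.\<close>

lemma recurrence_solution_initial:
  assumes "p < s" "i < s"
  shows "(\<Sum>c<s + n. recurrence_solution n p c * (if c = n + i then 1 else 0))
    = (if p = i then 1 else 0)"
proof -
  have "(\<Sum>c<s + n. recurrence_solution n p c * (if c = n + i then 1 else 0))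
      = (\<Sum>c<s + n. if c = n + i then recurrence_solution n p c else 0)"
    by (intro sum.cong) auto
  also have "\<dots> = recurrence_solution n p (n + i)"
    using assms by simp
  also have "\<dots> = (C ^\<^sub>m 0) $$ (p, i)"
    using assms by (intro recurrence_solution_eq) auto
  finally show ?thesis
    using assms companion_carrier by simp
qed

section \<open>Determinants of the block identity\<close>

lemma det_toeplitz_band:
  "det (toeplitz_band r s a n)
    = (- 1) ^ (n * s) * a s ^ n * det (submatrix (C ^\<^sub>m n) {..<s} {..<s})"
proof -
  let ?x = "recurrence_solution n"
  let ?b = "band_entry r s a"
  let ?e = "\<lambda>c i. if c = n + i then 1 else (0 :: 'a)"
  let ?M = "mat s s (\<lambda>(p, c). ?x p c)" and ?W = "mat s n (\<lambda>(p, c). ?x p (c + s))"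
  let ?U = "mat s n (\<lambda>(c, i). ?b c i)" and ?T = "mat n n (\<lambda>(c, i). ?b (c + s) i)"
  let ?V = "mat s s (\<lambda>(c, i). ?e c i)" and ?F = "mat n s (\<lambda>(c, i). ?e (c + s) i)"
  let ?G = "four_block_mat ?M ?W (0\<^sub>m n s) (1\<^sub>m n)"
  let ?L = "four_block_mat ?U ?V ?T ?F"
  \<comment> \<open>This is \<open>recurrence_solution_eq\<close> with \<open>t = n\<close> and
    \<open>j = c\<close>.\<close>
  have M: "submatrix (C ^\<^sub>m n) {..<s} {..<s} = ?M"
    using companion_pow_carrier[of n]
    by (subst submatrix_lessThan) (auto intro!: cong_mat recurrence_solution_eq[symmetric])
  have G: "?G \<in> carrier_mat (s + n) (s + n)"
    by (rule four_block_carrier_mat) auto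
  have L: "?L \<in> carrier_mat (s + n) (s + n)"
    by (rule carrier_matI) (simp_all only: index_mat_four_block dim_row_mat dim_col_mat add.commute)
  \<comment> \<open>Column \<open>i < n\<close> starts in row \<open>i\<close> with
    \<open>a s\<close>; column \<open>n + i\<close> is the unit vector with its 1 in row
    \<open>n + i\<close>.\<close>
  have "det ?L = prod_list (diag_mat ?L)"
    using L by (intro det_lower_triangular[of "s + n"]) (auto simp: band_entry_def)
  also have "\<dots> = (\<Prod>i = 0..<s + n. if i < n then a s else 1)"
    unfolding prod_list_diag_prod
    by (rule prod.cong) (auto simp: band_entry_def band_coeff_def)
  also have "\<dots> = (\<Prod>i \<in> {0..<s + n} \<inter> {..<n}. a s)"
    by (subst prod.inter_restrict) auto
  also have "{0..<s + n} \<inter> {..<n} = {..<n}"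
    by auto
  finally have det_L: "det ?L = a s ^ n"
    by simp
  have det_G: "det ?G = det ?M"
    by (subst det_four_block_mat_lower_left_zero[of _ s _ n]) auto
  have "?G * ?L = four_block_mat (?M * ?U + ?W * ?T) (?M * ?V + ?W * ?F)
      (0\<^sub>m n s * ?U + 1\<^sub>m n * ?T) (0\<^sub>m n s * ?V + 1\<^sub>m n * ?F)"
    by (rule mult_four_block_mat) auto
  also have "?M * ?U + ?W * ?T = 0\<^sub>m s n"
    unfolding block_row_mult by (intro eq_matI) (auto simp: recurrence_solution_band)
  also have "?M * ?V + ?W * ?F = 1\<^sub>m s"
    unfolding block_row_mult[where Y = ?e]
    by (intro eq_matI) (auto simp: recurrence_solution_initial)
  also have "0\<^sub>m n s * ?U + 1\<^sub>m n * ?T = ?T"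
    by (subst left_mult_zero_mat[of _ s n], simp, subst left_mult_one_mat[of _ n n], auto)
  also have "0\<^sub>m n s * ?V + 1\<^sub>m n * ?F = ?F"
    by (subst left_mult_zero_mat[of _ s s], simp, subst left_mult_one_mat[of _ n s], auto)
  finally have "det ?G * det ?L = det (four_block_mat (0\<^sub>m s n) (1\<^sub>m s) ?T ?F)"
    using det_mult[OF G L] by simp
  also have "\<dots> = (- 1) ^ (n * s) * det ?T"
    by (rule det_four_block_mat_zero_one) auto
  \<comment> \<open>The sign is its own inverse, so it can change sides.\<close>
  finally have "det ?T = (- 1) ^ (n * s) * (det ?M * a s ^ n)"
    by (simp add: det_G det_L flip: mult.assoc power_mult_distrib)
  then show ?thesis
    by (simp add: toeplitz_band_eq M mult_ac)
qed

end

theorem theorem1p1: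
  fixes a :: "nat \<Rightarrow> 'a :: field"
    and r s k n :: nat
    and M :: "'a mat"
  assumes "r \<ge> 1" and "s \<ge> 1" and "k = r + s"
    and "a s \<noteq> 0" and "a (s + r) \<noteq> 0"
    and "n \<ge> k"
    and "M = submatrix (toeplitz_companion r s a ^\<^sub>m n) {..<s} {..<s}"
  shows "det (toeplitz_band r s a n) = (- 1) ^ (n * s) * a s ^ n * det M"
  using det_toeplitz_band[of s a r n] assms(2,4,7) by simp

end
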